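(* Let $f:\mathbb{R}^n\to\mathbb{R}^n$ be a function, $F:\mathbb{R}^n\rightrightarrows\mathbb{R}^n$ a set-valued map and $p:[0,1]\to\mathbb{R}^n$ a continuous function. For $t\in[0,1]$ let $G_t(v)=f(v)-p(t)+F(v)$ and $S(t)=\{z\in\mathbb{R}^n : 0\in G_t(z)\}$. Assume that (i) $z:[0,1]\to\mathbb{R}^n$ is a continuous solution trajectory for $S$, i.e. $z$ is continuous and $z(t)\in S(t)$ for all $t\in[0,1]$; (ii) for every $t\in[0,1]$, $G_t$ is strongly metrically regular at $z(t)$ for $0$. Then there exist constants $a,b,\kappa>0$ such that for every $t\in[0,1]$ the mapping $\mathbb{B}_b(0)\ni y\mapsto G_t^{-1}(y)\cap\mathbb{B}_a(z(t))$ is single-valued and Lipschitz continuous with constant $\kappa$, and such that the following holds: for every $\epsilon$ with $0<\epsilon<b/4$ and every continuous function $\widetilde p:[0,1]\to\mathbb{R}^n$ with $\|\widetilde p(t)-p(t)\|<\epsilon$ for all $t\in[0,1]$, there exists a continuous function $\widetilde z:[0,1]\to\mathbb{R}^n$ with $$\widetilde z(t)\in\widetilde S(t):=\{v\in\mathbb{R}^n : 0\in f(v)-\widetilde p(t)+F(v)\}\quad\text{for all } t\in[0,1]$$ and $$\|\widetilde z(t)-z(t)\|<\frac{4a\epsilon}{b}\quad\text{for all } t\in[0,1].$$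
   Context: For a set-valued map $H:\mathbb{R}^n\rightrightarrows\mathbb{R}^n$, $H^{-1}(y)=\{x: y\in H(x)\}$. $\mathbb{B}_r(x)$ denotes the closed ball of radius $r$ centred at $x$. "Single-valued" means that the set has exactly one element for each $y$ in the indicated ball. $G_t$ is strongly metrically regular at $z(t)$ for $0$ if $0\in G_t(z(t))$ and there exist constants $a_t,b_t,\kappa_t>0$ (possibly depending on $t$) such that the mapping $\mathbb{B}_{b_t}(0)\ni y\mapsto G_t^{-1}(y)\cap\mathbb{B}_{a_t}(z(t))$ is single-valued and Lipschitz continuous with Lipschitz constant $\kappa_t$. *)

theory Defs
  imports "HOL-Analysis.Analysis"
begin

text \<open>Set-valued maps are modelled as functions into sets; values may be empty.\<close>

definition setval_inverse :: "('a \<Rightarrow> 'b set) \<Rightarrow> 'b \<Rightarrow> 'a set" where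
  "setval_inverse H y = {x. y \<in> H x}"

text \<open>
  The mapping sending y in the closed ball of radius b around y0 to
  the intersection of the inverse image of y with the closed ball of radius a around x0
  is single-valued and Lipschitz continuous with constant k.
  Lipschitz continuity refers to the unique element of each value.
\<close>

definition single_valued_lipschitz_localization ::
  "('a::metric_space \<Rightarrow> 'b::metric_space set) \<Rightarrow> 'a \<Rightarrow> 'b \<Rightarrow> real \<Rightarrow> real \<Rightarrow> real \<Rightarrow> bool" where
  "single_valued_lipschitz_localization H x0 y0 a b k \<longleftrightarrow>
     (\<forall>y\<in>cball y0 b. is_singleton (setval_inverse H y \<inter> cball x0 a)) \<and>
     k-lipschitz_on (cball y0 b) (\<lambda>y. the_elem (setval_inverse H y \<inter> cball x0 a))"

definition strongly_metrically_regular ::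
  "('a::metric_space \<Rightarrow> 'b::metric_space set) \<Rightarrow> 'a \<Rightarrow> 'b \<Rightarrow> bool" where
  "strongly_metrically_regular H x0 y0 \<longleftrightarrow>
     y0 \<in> H x0 \<and>
     (\<exists>a>0. \<exists>b>0. \<exists>k>0. single_valued_lipschitz_localization H x0 y0 a b k)"

definition param_map ::
  "('a \<Rightarrow> 'b::ab_group_add) \<Rightarrow> ('a \<Rightarrow> 'b set) \<Rightarrow> (real \<Rightarrow> 'b) \<Rightarrow> real \<Rightarrow> 'a \<Rightarrow> 'b set" where
  "param_map f F p t v = {f v - p t + w | w. w \<in> F v}"

definition solution_map ::
  "('a \<Rightarrow> 'b::ab_group_add) \<Rightarrow> ('a \<Rightarrow> 'b set) \<Rightarrow> (real \<Rightarrow> 'b) \<Rightarrow> real \<Rightarrow> 'a set" where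
  "solution_map f F p t = {v. 0 \<in> param_map f F p t v}"

end

theory Submission
  imports Defs
begin

text \<open>
  The map \<open>G\<^sub>t\<close> is a translate of the fixed map \<open>H(v) = f(v) + F(v)\<close>, so a localization of
  \<open>G\<^sub>t\<close> at \<open>(z(t), 0)\<close> is a localization of \<open>H\<close> at \<open>(z(t), p(t))\<close>. A localization of \<open>H\<close> at a
  point of its graph restricts to nearby points of the graph, with the same Lipschitz constant,
  and for all small radii satisfying \<open>\<kappa> b \<le> a\<close>. Compactness of the interval therefore gives uniform
  constants with \<open>\<kappa> b \<le> a\<close>. The perturbed trajectory is the localized inverse of \<open>H\<close> at time \<open>t\<close>
  evaluated at the perturbed parameter; its distance from \<open>z(t)\<close> is below \<open>\<kappa> \<epsilon> \<le> a \<epsilon> / b\<close>.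
\<close>

section \<open>Localizations as selections, and their behaviour under translation\<close>

text \<open>Trades \<open>the_elem\<close> for an explicit selection \<open>s\<close>, which can be
  shifted, restricted and compared with other selections.\<close>

lemma single_valued_lipschitz_localization_iff:
  "single_valued_lipschitz_localization H x0 y0 a b k \<longleftrightarrow>
     (\<exists>s. (\<forall>y\<in>cball y0 b. setval_inverse H y \<inter> cball x0 a = {s y}) \<and>
          k-lipschitz_on (cball y0 b) s)" (is "?L \<longleftrightarrow> ?R")
proof
  assume L: ?L
  show ?R
  proof (intro exI conjI)
    let ?s = "\<lambda>y. the_elem (setval_inverse H y \<inter> cball x0 a)"
    show "\<forall>y\<in>cball y0 b. setval_inverse H y \<inter> cball x0 a = {?s y}"
      using L by (auto simp: single_valued_lipschitz_localization_def is_singleton_the_elem)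
    show "k-lipschitz_on (cball y0 b) ?s"
      using L by (simp add: single_valued_lipschitz_localization_def)
  qed
next
  assume ?R
  then obtain s where s: "\<And>y. y \<in> cball y0 b \<Longrightarrow> setval_inverse H y \<inter> cball x0 a = {s y}"
    and lip: "k-lipschitz_on (cball y0 b) s"
    by blast
  have "k-lipschitz_on (cball y0 b) (\<lambda>y. the_elem (setval_inverse H y \<inter> cball x0 a))"
    by (rule lipschitz_on_transform[OF lip]) (simp add: s)
  then show ?L
    using s by (simp add: single_valued_lipschitz_localization_def)
qed

text \<open>The shift by \<open>y0\<close> is an isometry from the ball around \<open>0\<close> onto
  the ball around \<open>y0\<close>, so composing the selection with it or its inverse keeps all
  three constants.\<close>

lemma single_valued_lipschitz_localization_translate:
  fixes y0 :: "'b::real_normed_vector"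
  assumes "\<And>y. setval_inverse G y = setval_inverse H (y + y0)"
  shows "single_valued_lipschitz_localization G x0 0 a b k \<longleftrightarrow>
         single_valued_lipschitz_localization H x0 y0 a b k" (is "?L \<longleftrightarrow> ?R")
proof -
  have mem: "y - y0 \<in> cball 0 b \<longleftrightarrow> y \<in> cball y0 b" for y
    by (simp add: dist_norm norm_minus_commute)
  have mem': "y + y0 \<in> cball y0 b \<longleftrightarrow> y \<in> cball 0 b" for y
    by (simp add: dist_norm)
  have shift: "dist (x - y0) (y - y0) = dist x y" "dist (x + y0) (y + y0) = dist x y" for x y
    by (simp_all add: dist_norm)
  show ?thesis
  proof
    assume ?L
    then obtain s where
      s: "\<And>y. y \<in> cball 0 b \<Longrightarrow> setval_inverse G y \<inter> cball x0 a = {s y}"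
      and lip: "k-lipschitz_on (cball 0 b) s"
      unfolding single_valued_lipschitz_localization_iff by blast
    have "\<forall>y\<in>cball y0 b. setval_inverse H y \<inter> cball x0 a = {s (y - y0)}"
    proof
      fix y assume "y \<in> cball y0 b"
      then have "setval_inverse G (y - y0) \<inter> cball x0 a = {s (y - y0)}"
        using s mem by blast
      then show "setval_inverse H y \<inter> cball x0 a = {s (y - y0)}"
        by (simp add: assms)
    qed
    moreover have "k-lipschitz_on (cball y0 b) (\<lambda>y. s (y - y0))"
      using lip mem shift(1) unfolding lipschitz_on_def by metis
    ultimately show ?R
      unfolding single_valued_lipschitz_localization_iff
      by (intro exI[of _ "\<lambda>y. s (y - y0)"] conjI)
  next
    assume ?R
    then obtain s where
      s: "\<And>y. y \<in> cball y0 b \<Longrightarrow> setval_inverse H y \<inter> cball x0 a = {s y}"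
      and lip: "k-lipschitz_on (cball y0 b) s"
      unfolding single_valued_lipschitz_localization_iff by blast
    have "\<forall>y\<in>cball 0 b. setval_inverse G y \<inter> cball x0 a = {s (y + y0)}"
      using s mem' assms by simp
    moreover have "k-lipschitz_on (cball 0 b) (\<lambda>y. s (y + y0))"
      using lip mem' shift(2) unfolding lipschitz_on_def by metis
    ultimately show ?L
      unfolding single_valued_lipschitz_localization_iff
      by (intro exI[of _ "\<lambda>y. s (y + y0)"] conjI)
  qed
qed

text \<open>All dependence on \<open>t\<close> is moved into the argument of one fixed inverse map;
  this is the hypothesis of the translation lemma.\<close>

lemma setval_inverse_param_map:
  "setval_inverse (param_map f F p t) y = setval_inverse (\<lambda>v. (\<lambda>w. f v + w) ` F v) (y + p t)"
  by (auto simp: setval_inverse_def param_map_def algebra_simps image_iff)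

lemma mem_solution_map:
  "v \<in> solution_map f F p t \<longleftrightarrow> p t \<in> (\<lambda>w. f v + w) ` F v"
  using setval_inverse_param_map[of f F p t 0]
  by (auto simp: solution_map_def setval_inverse_def)

section \<open>Restriction to nearby graph points and uniform constants\<close>

lemma cball_subset_cballI:
  fixes x x' :: "'a::metric_space"
  assumes "dist x x' + r \<le> r'"
  shows "cball x r \<subseteq> cball x' r'"
proof
  fix w assume "w \<in> cball x r"
  then show "w \<in> cball x' r'"
    using assms dist_triangle[of x' w x] by (simp add: dist_commute)
qed

text \<open>Uniqueness in the larger ball forces \<open>s y1 = x1\<close>. By the Lipschitz bound
  \<open>s y\<close> then stays within \<open>k * b \<le> a\<close> of \<open>x1\<close>, so it
  survives in the smaller ball, where uniqueness is inherited. Allowing \<open>k\<close> above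
  \<open>k0\<close> lets constants from different base points be merged.\<close>

lemma single_valued_lipschitz_localization_nearby:
  assumes loc: "single_valued_lipschitz_localization H x0 y0 a0 b0 k0"
    and graph: "y1 \<in> H x1"
    and x1: "dist x1 x0 + a \<le> a0" and y1: "dist y1 y0 + b \<le> b0"
    and "0 \<le> a" "0 \<le> b" "k0 \<le> k" "k * b \<le> a"
  shows "single_valued_lipschitz_localization H x1 y1 a b k"
proof -
  obtain s where s: "\<And>y. y \<in> cball y0 b0 \<Longrightarrow> setval_inverse H y \<inter> cball x0 a0 = {s y}"
    and lip: "k0-lipschitz_on (cball y0 b0) s"
    using loc unfolding single_valued_lipschitz_localization_iff by blast
  have sub_x: "cball x1 a \<subseteq> cball x0 a0" and sub_y: "cball y1 b \<subseteq> cball y0 b0"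
    using x1 y1 by (simp_all add: cball_subset_cballI)
  have y1_in: "y1 \<in> cball y0 b0" and x1_in: "x1 \<in> cball x0 a0"
    using x1 y1 \<open>0 \<le> a\<close> \<open>0 \<le> b\<close> by (simp_all add: dist_commute)
  have sy1: "s y1 = x1"
    using s[OF y1_in] x1_in graph by (metis IntI mem_Collect_eq setval_inverse_def singletonD)
  have lip': "k-lipschitz_on (cball y1 b) s"
    using lip sub_y \<open>k0 \<le> k\<close> by (meson lipschitz_on_subset lipschitz_on_le)
  have "setval_inverse H y \<inter> cball x1 a = {s y}" if y: "y \<in> cball y1 b" for y
  proof -
    have "dist x1 (s y) \<le> k * dist y1 y"
      using lipschitz_onD[OF lip', of y1 y] y \<open>0 \<le> b\<close> sy1 by simp
    also have "\<dots> \<le> k * b"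
      using y lipschitz_on_nonneg[OF lip'] by (intro mult_left_mono) auto
    finally have "s y \<in> cball x1 a"
      using \<open>k * b \<le> a\<close> by simp
    then show ?thesis
      using s[of y] y sub_x sub_y by blast
  qed
  then show ?thesis
    using lip' unfolding single_valued_lipschitz_localization_iff by blast
qed

lemma uniform_single_valued_lipschitz_localization:
  fixes z :: "real \<Rightarrow> 'a::metric_space" and p :: "real \<Rightarrow> 'b::metric_space"
  assumes "c \<le> d" and z: "continuous_on {c..d} z" and p: "continuous_on {c..d} p"
    and smr: "\<And>t. t \<in> {c..d} \<Longrightarrow> strongly_metrically_regular H (z t) (p t)"
  obtains a b k where "a > 0" "b > 0" "k > 0" "k * b \<le> a"
    "\<And>t. t \<in> {c..d} \<Longrightarrow> single_valued_lipschitz_localization H (z t) (p t) a b k"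
proof -
  \<comment> \<open>Quantifying over all admissible smaller radii and larger constants makes
    \<open>Q\<close> monotone, so bounds from two intervals combine by \<open>min\<close> and
    \<open>max\<close>.\<close>
  define Q where "Q A B K t \<longleftrightarrow> (\<forall>a b k.
      0 < a \<and> a \<le> A \<and> 0 < b \<and> b \<le> B \<and> K \<le> k \<and> k * b \<le> a \<longrightarrow>
      single_valued_lipschitz_localization H (z t) (p t) a b k)" for A B K t
  have Q_mono: "Q A' B' K' t" if "Q A B K t" "A' \<le> A" "B' \<le> B" "K \<le> K'" for A B K A' B' K' t
    unfolding Q_def
  proof (intro allI impI)
    fix a b k
    assume "0 < a \<and> a \<le> A' \<and> 0 < b \<and> b \<le> B' \<and> K' \<le> k \<and> k * b \<le> a"
    then show "single_valued_lipschitz_localization H (z t) (p t) a b k"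
      by (intro that(1)[unfolded Q_def, rule_format]) (use that(2-4) in linarith)
  qed
  \<comment> \<open>Compactness enters through bisection. The intersection with
    \<open>{c..d}\<close> is there because the local case of \<open>Bolzano\<close> also ranges over
    intervals that stick out of \<open>{c..d}\<close>.\<close>
  define P where "P u v \<longleftrightarrow> (\<exists>A>0. \<exists>B>0. \<exists>K>0. \<forall>t\<in>{u..v} \<inter> {c..d}. Q A B K t)" for u v
  from \<open>c \<le> d\<close> have "P c d"
  proof (induction rule: Bolzano)
    case (trans u v w)
    obtain A B K where 1: "A > 0" "B > 0" "K > 0" "\<And>t. t \<in> {u..v} \<inter> {c..d} \<Longrightarrow> Q A B K t"
      using \<open>P u v\<close> unfolding P_def by blast
    obtain A' B' K' where 2: "A' > 0" "B' > 0" "K' > 0" "\<And>t. t \<in> {v..w} \<inter> {c..d} \<Longrightarrow> Q A' B' K' t"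
      using \<open>P v w\<close> unfolding P_def by blast
    have "Q (min A A') (min B B') (max K K') t" if t: "t \<in> {u..w} \<inter> {c..d}" for t
    proof (cases "t \<le> v")
      case True
      with 1(4)[of t] t show ?thesis by (auto intro: Q_mono)
    next
      case False
      with 2(4)[of t] t show ?thesis by (auto intro: Q_mono)
    qed
    moreover have "min A A' > 0" "min B B' > 0" "max K K' > 0"
      using 1 2 by auto
    ultimately show ?case
      unfolding P_def by blast
  next
    case (local t0)
    then have t0: "t0 \<in> {c..d}" by simp
    obtain A B K where pos: "A > 0" "B > 0" "K > 0"
      and loc: "single_valued_lipschitz_localization H (z t0) (p t0) A B K"
      using smr[OF t0] unfolding strongly_metrically_regular_def by blast
    \<comment> \<open>Half of each radius pays for the displacement of the centre, the other half
      for the new ball.\<close>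
    obtain d1 where d1: "d1 > 0" "\<forall>t\<in>{c..d}. dist t t0 < d1 \<longrightarrow> dist (z t) (z t0) < A / 2"
      using z[unfolded continuous_on_iff, rule_format, OF t0, of "A / 2"] \<open>A > 0\<close> by auto
    obtain d2 where d2: "d2 > 0" "\<forall>t\<in>{c..d}. dist t t0 < d2 \<longrightarrow> dist (p t) (p t0) < B / 2"
      using p[unfolded continuous_on_iff, rule_format, OF t0, of "B / 2"] \<open>B > 0\<close> by auto
    have "P u v" if uv: "u \<le> t0 \<and> t0 \<le> v \<and> v - u < min d1 d2" for u v
    proof -
      have "Q (A / 2) (B / 2) K t" if t: "t \<in> {u..v} \<inter> {c..d}" for t
        unfolding Q_def
      proof (intro allI impI)
        fix a b k
        assume abk: "0 < a \<and> a \<le> A / 2 \<and> 0 < b \<and> b \<le> B / 2 \<and> K \<le> k \<and> k * b \<le> a"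
        have "dist t t0 < min d1 d2"
          using t uv by (auto simp: dist_real_def)
        then have near: "dist (z t) (z t0) < A / 2" "dist (p t) (p t0) < B / 2"
          using t d1(2) d2(2) by simp_all
        have "p t \<in> H (z t)"
          using smr t unfolding strongly_metrically_regular_def by blast
        then show "single_valued_lipschitz_localization H (z t) (p t) a b k"
          by (rule single_valued_lipschitz_localization_nearby[OF loc]) (use abk near in linarith)+
      qed
      moreover have "A / 2 > 0" "B / 2 > 0"
        using pos by simp_all
      ultimately show ?thesis
        unfolding P_def using pos(3) by blast
    qed
    then show ?case
      using d1(1) d2(1) by (intro exI[of _ "min d1 d2"]) simp
  qed
  then obtain A B K where ABK: "A > 0" "B > 0" "K > 0" "\<And>t. t \<in> {c..d} \<Longrightarrow> Q A B K t"
    unfolding P_def by auto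
  show thesis
  \<comment> \<open>The second radius is the largest one below \<open>B\<close> that satisfies
    \<open>K * b \<le> A\<close>.\<close>
  proof (rule that[of A "min B (A / K)" K])
    show "A > 0" "K > 0" "min B (A / K) > 0"
      using ABK by simp_all
    show KB: "K * min B (A / K) \<le> A"
      using \<open>K > 0\<close> by (auto simp: min_def field_simps)
    show "single_valued_lipschitz_localization H (z t) (p t) A (min B (A / K)) K"
      if "t \<in> {c..d}" for t
      by (rule ABK(4)[OF that, unfolded Q_def, rule_format]) (use KB ABK in auto)
  qed
qed

section \<open>Continuous selection along a perturbed parameter\<close>

text \<open>The selections \<open>s t\<close> are chosen separately for each \<open>t\<close>.
  Continuity of \<open>s t (q t)\<close> still holds because for \<open>t\<close> near
  \<open>t0\<close> uniqueness gives \<open>s t (q t) = s t0 (q t)\<close>, and the fixed map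
  \<open>s t0\<close> is Lipschitz.\<close>

lemma continuous_selection_near_trajectory:
  fixes z :: "'t::topological_space \<Rightarrow> 'a::metric_space" and p q :: "'t \<Rightarrow> 'b::metric_space"
  assumes z: "continuous_on T z" and q: "continuous_on T q"
    and loc: "\<And>t. t \<in> T \<Longrightarrow> single_valued_lipschitz_localization H (z t) (p t) a b k"
    and graph: "\<And>t. t \<in> T \<Longrightarrow> p t \<in> H (z t)"
    and close: "\<And>t. t \<in> T \<Longrightarrow> dist (q t) (p t) < b"
    and "0 < a" "0 < k" "k * b \<le> a"
  obtains x where "continuous_on T x" "\<And>t. t \<in> T \<Longrightarrow> q t \<in> H (x t)"
    "\<And>t. t \<in> T \<Longrightarrow> dist (x t) (z t) \<le> k * dist (q t) (p t)"
proof -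
  have "\<forall>t\<in>T. \<exists>s. (\<forall>y\<in>cball (p t) b. setval_inverse H y \<inter> cball (z t) a = {s y}) \<and>
      k-lipschitz_on (cball (p t) b) s"
    using loc unfolding single_valued_lipschitz_localization_iff by blast
  then obtain s where
    s: "\<And>t y. t \<in> T \<Longrightarrow> y \<in> cball (p t) b \<Longrightarrow> setval_inverse H y \<inter> cball (z t) a = {s t y}"
    and lip: "\<And>t. t \<in> T \<Longrightarrow> k-lipschitz_on (cball (p t) b) (s t)"
    by metis
  have q_in: "q t \<in> cball (p t) b" if "t \<in> T" for t
    using close[OF that] by (simp add: dist_commute)
  have dist_s: "dist (s t y) (z t) \<le> k * dist y (p t)" if t: "t \<in> T" and y: "y \<in> cball (p t) b" for t y
  proof -
    \<comment> \<open>The ball contains \<open>y\<close>, which gives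
      \<open>0 \<le> b\<close>.\<close>
    have p_in: "p t \<in> cball (p t) b"
      using y zero_le_dist[of "p t" y] by (simp del: zero_le_dist)
    have "s t (p t) = z t"
      using s[OF t p_in] graph[OF t] \<open>0 < a\<close>
      by (metis IntI centre_in_cball less_imp_le mem_Collect_eq setval_inverse_def singletonD)
    then show ?thesis
      using lipschitz_onD[OF lip[OF t] y p_in] by simp
  qed
  show thesis
  proof (rule that[of "\<lambda>t. s t (q t)"])
    show "q t \<in> H (s t (q t))" if "t \<in> T" for t
      using s[OF that q_in[OF that]] by (auto simp: setval_inverse_def)
    show "dist (s t (q t)) (z t) \<le> k * dist (q t) (p t)" if "t \<in> T" for t
      by (rule dist_s[OF that q_in[OF that]])
    show "continuous_on T (\<lambda>t. s t (q t))"
      unfolding continuous_on_def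
    proof
      fix t0 assume t0: "t0 \<in> T"
      have q_lim: "(q \<longlongrightarrow> q t0) (at t0 within T)" and z_lim: "(z \<longlongrightarrow> z t0) (at t0 within T)"
        using q z t0 by (auto simp: continuous_on_def)
      have in_T: "\<forall>\<^sub>F t in at t0 within T. t \<in> T"
        by (simp add: eventually_at_topological) blast
      \<comment> \<open>The strict bound at \<open>t0\<close> persists nearby, so
        \<open>s t0\<close> may be evaluated at \<open>q t\<close>.\<close>
      have "((\<lambda>t. dist (q t) (p t0)) \<longlongrightarrow> dist (q t0) (p t0)) (at t0 within T)"
        by (intro tendsto_intros q_lim)
      then have near_b: "\<forall>\<^sub>F t in at t0 within T. dist (q t) (p t0) < b"
        by (rule order_tendstoD(2)) (rule close[OF t0])
      \<comment> \<open>This expression bounds the distance from \<open>s t0 (q t)\<close> to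
        \<open>z t\<close>. At \<open>t0\<close> it is strictly below \<open>k * b \<le> a\<close>,
        so for nearby \<open>t\<close> the point lies in the ball where the localization at
        \<open>t\<close> is unique.\<close>
      have "((\<lambda>t. k * dist (q t) (p t0) + dist (z t0) (z t)) \<longlongrightarrow>
          k * dist (q t0) (p t0) + dist (z t0) (z t0)) (at t0 within T)"
        by (intro tendsto_intros q_lim z_lim)
      moreover have "k * dist (q t0) (p t0) + dist (z t0) (z t0) < a"
        using mult_strict_left_mono[OF close[OF t0] \<open>0 < k\<close>] \<open>k * b \<le> a\<close> by simp
      ultimately have near_a:
        "\<forall>\<^sub>F t in at t0 within T. k * dist (q t) (p t0) + dist (z t0) (z t) < a"
        by (rule order_tendstoD(2))
      \<comment> \<open>The localizations at \<open>t\<close> and at \<open>t0\<close> select the same point.\<close>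
      have "\<forall>\<^sub>F t in at t0 within T. dist (s t (q t)) (s t0 (q t0)) \<le> k * dist (q t) (q t0)"
        using in_T near_b near_a
      proof eventually_elim
        case (elim t)
        have q_in0: "q t \<in> cball (p t0) b"
          using elim by (simp add: dist_commute)
        have "dist (s t0 (q t)) (z t) \<le> k * dist (q t) (p t0) + dist (z t0) (z t)"
          using dist_triangle[of "s t0 (q t)" "z t" "z t0"] dist_s[OF t0 q_in0] by linarith
        then have "s t0 (q t) \<in> cball (z t) a"
          using elim by (simp add: dist_commute)
        moreover have "s t0 (q t) \<in> setval_inverse H (q t)"
          using s[OF t0 q_in0] by blast
        ultimately have "s t0 (q t) \<in> {s t (q t)}"
          using s[OF elim(1) q_in[OF elim(1)]] by (metis IntI)
        then have "s t (q t) = s t0 (q t)"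
          by simp
        then show ?case
          using lipschitz_onD[OF lip[OF t0] q_in0 q_in[OF t0]] by simp
      qed
      moreover have "((\<lambda>t. k * dist (q t) (q t0)) \<longlongrightarrow> k * dist (q t0) (q t0)) (at t0 within T)"
        by (intro tendsto_intros q_lim)
      ultimately have "((\<lambda>t. dist (s t (q t)) (s t0 (q t0))) \<longlongrightarrow> 0) (at t0 within T)"
        using tendsto_sandwich[of "\<lambda>_. 0" "\<lambda>t. dist (s t (q t)) (s t0 (q t0))"
            "at t0 within T" "\<lambda>t. k * dist (q t) (q t0)" 0]
        by simp
      then show "((\<lambda>t. s t (q t)) \<longlongrightarrow> s t0 (q t0)) (at t0 within T)"
        by (rule tendsto_dist_iff[THEN iffD2])
    qed
  qed
qed

section \<open>Perturbation of the solution trajectory\<close>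

theorem theorem4p2p15:
  fixes f :: "real ^ 'n \<Rightarrow> real ^ 'n"
    and F :: "real ^ 'n \<Rightarrow> (real ^ 'n) set"
    and p z :: "real \<Rightarrow> real ^ 'n"
  assumes p_cont: "continuous_on {0..1} p"
    and z_cont: "continuous_on {0..1} z"
    and z_sol: "\<forall>t\<in>{0..1}. z t \<in> solution_map f F p t"
    and smr: "\<forall>t\<in>{0..1}. strongly_metrically_regular (param_map f F p t) (z t) 0"
  shows "\<exists>a>0. \<exists>b>0. \<exists>\<kappa>>0.
    (\<forall>t\<in>{0..1}. single_valued_lipschitz_localization (param_map f F p t) (z t) 0 a b \<kappa>) \<and>
    (\<forall>\<epsilon> pt. 0 < \<epsilon> \<and> \<epsilon> < b / 4 \<and> continuous_on {0..1} pt \<and>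
        (\<forall>t\<in>{0..1}. norm (pt t - p t) < \<epsilon>) \<longrightarrow>
      (\<exists>zt. continuous_on {0..1} zt \<and>
        (\<forall>t\<in>{0..1}. zt t \<in> solution_map f F pt t) \<and>
        (\<forall>t\<in>{0..1}. norm (zt t - z t) < 4 * a * \<epsilon> / b)))"
proof -
  define H where "H v = (\<lambda>w. f v + w) ` F v" for v
  have loc_iff: "single_valued_lipschitz_localization (param_map f F p t) x 0 a b k \<longleftrightarrow>
      single_valued_lipschitz_localization H x (p t) a b k" for t x a b k
    by (rule single_valued_lipschitz_localization_translate)
      (simp add: setval_inverse_param_map H_def[abs_def])
  have sol_iff: "v \<in> solution_map f F q t \<longleftrightarrow> q t \<in> H v" for q v t
    by (simp add: mem_solution_map H_def)
  have graph: "p t \<in> H (z t)" if "t \<in> {0..1}" for t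
    using z_sol that sol_iff by blast
  have "strongly_metrically_regular H (z t) (p t)" if "t \<in> {0..1}" for t
    using smr that graph unfolding strongly_metrically_regular_def loc_iff by blast
  then obtain a b \<kappa> where pos: "a > 0" "b > 0" "\<kappa> > 0" and \<kappa>b: "\<kappa> * b \<le> a"
    and loc: "\<And>t. t \<in> {0..1} \<Longrightarrow> single_valued_lipschitz_localization H (z t) (p t) a b \<kappa>"
    using uniform_single_valued_lipschitz_localization[OF zero_le_one z_cont p_cont] by metis
  have "\<exists>zt. continuous_on {0..1} zt \<and> (\<forall>t\<in>{0..1}. zt t \<in> solution_map f F pt t) \<and>
        (\<forall>t\<in>{0..1}. norm (zt t - z t) < 4 * a * \<epsilon> / b)"
    if \<epsilon>: "0 < \<epsilon>" "\<epsilon> < b / 4" and pt: "continuous_on {0..1} pt"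
      and near: "\<forall>t\<in>{0..1}. norm (pt t - p t) < \<epsilon>" for \<epsilon> pt
  proof -
    \<comment> \<open>From \<open>\<epsilon> < b / 4\<close> and \<open>b > 0\<close>, so the
      perturbed parameter stays in the domain of each localization.\<close>
    have "dist (pt t) (p t) < b" if "t \<in> {0..1}" for t
      using near that \<epsilon> pos by (force simp: dist_norm)
    then obtain zt where zt: "continuous_on {0..1} zt" "\<And>t. t \<in> {0..1} \<Longrightarrow> pt t \<in> H (zt t)"
      "\<And>t. t \<in> {0..1} \<Longrightarrow> dist (zt t) (z t) \<le> \<kappa> * dist (pt t) (p t)"
      using continuous_selection_near_trajectory[OF z_cont pt loc graph _ pos(1,3) \<kappa>b] by blast
    have "norm (zt t - z t) < 4 * a * \<epsilon> / b" if t: "t \<in> {0..1}" for t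
    proof -
      have "norm (zt t - z t) \<le> \<kappa> * norm (pt t - p t)"
        using zt(3)[OF t] by (simp add: dist_norm)
      also have "\<dots> < \<kappa> * \<epsilon>"
        using near t pos by simp
      also have "\<dots> \<le> a / b * \<epsilon>"
        using \<kappa>b pos \<epsilon> by (intro mult_right_mono) (simp_all add: field_simps)
      \<comment> \<open>The bound reached so far is already \<open>a * \<epsilon> / b\<close>; the
        factor 4 is slack.\<close>
      also have "\<dots> \<le> 4 * a * \<epsilon> / b"
        using pos \<epsilon> by (simp add: field_simps)
      finally show ?thesis .
    qed
    with zt show ?thesis
      using sol_iff by blast
  qed
  with pos loc show ?thesis
    unfolding loc_iff by blast
qed

end
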